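(* Let $\xi,\eta\in(\ell^1)^*$ with $\xi\prec_\infty\eta$. Then: (i) $\xi\preccurlyeq_\infty\zeta\le\eta$ for some $\zeta\in c_0^*$; (ii) $\xi\le\rho\preccurlyeq_\infty\eta$ for some $\rho\in c_0^*$.
   Context: $\mathbb N=\{1,2,3,\dots\}$. $c_0^*$ denotes the cone of nonincreasing sequences of nonnegative real numbers converging to $0$, and $(\ell^1)^*\subset c_0^*$ the subcone of summable ones (neither denotes a dual space). For sequences, $\xi\le\eta$ means $\xi_n\le\eta_n$ for all $n$. For $\xi,\eta\in(\ell^1)^*$: $\xi\prec_\infty\eta$ ($\eta$ majorizes $\xi$ at infinity) means $\sum_{j=n}^\infty\xi_j\le\sum_{j=n}^\infty\eta_j$ for every $n\in\mathbb N$; $\xi\preccurlyeq_\infty\eta$ ($\eta$ strongly majorizes $\xi$ at infinity) means $\xi\prec_\infty\eta$ and $\sum_{j=1}^\infty\xi_j=\sum_{j=1}^\infty\eta_j$. In both (i) and (ii), the assertion includes that the intermediate sequence lies in $(\ell^1)^*$, so that the relation $\preccurlyeq_\infty$ is meaningful. *)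

theory Defs
  imports "HOL-Analysis.Analysis"
begin

(* Sequences indexed by {1,2,3,...} are represented as functions on nat, shifted by one:
   x n is the (n+1)-st term.  The termwise order is the library's order on functions. *)

definition c0_star :: "(nat \<Rightarrow> real) set" where
  "c0_star = {x. decseq x \<and> (\<forall>n. 0 \<le> x n) \<and> x \<longlonglongrightarrow> 0}"

definition l1_star :: "(nat \<Rightarrow> real) set" where
  "l1_star = {x \<in> c0_star. summable x}"

(* The next two relations are meaningful only for summable sequences (suminf is unspecified
   otherwise), so they are to be used on l1_star.  The sum of x (j + n) over j is the tail
   of x starting at index n. *)

definition majorized_at_infinity :: "(nat \<Rightarrow> real) \<Rightarrow> (nat \<Rightarrow> real) \<Rightarrow> bool"
    (infix "\<prec>\<^sub>\<infinity>" 50) where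
  "x \<prec>\<^sub>\<infinity> y \<longleftrightarrow> (\<forall>n. (\<Sum>j. x (j + n)) \<le> (\<Sum>j. y (j + n)))"

definition strongly_majorized_at_infinity :: "(nat \<Rightarrow> real) \<Rightarrow> (nat \<Rightarrow> real) \<Rightarrow> bool"
    (infix "\<preceq>\<^sub>\<infinity>" 50) where
  "x \<preceq>\<^sub>\<infinity> y \<longleftrightarrow> x \<prec>\<^sub>\<infinity> y \<and> (\<Sum>j. x j) = (\<Sum>j. y j)"

end

theory Submission
  imports Defs
begin

text \<open>
  For the second part, add the missing mass to the first term of \<open>\<xi>\<close>.  For the first part,
  truncate \<open>\<eta>\<close> at the height \<open>c\<close> for which \<open>min \<eta> c\<close> has the same sum as \<open>\<xi>\<close>.  To compare the
  tails from \<open>n\<close> on, look at \<open>\<xi>\<close> before \<open>n\<close>: if it stays above \<open>c\<close> there, the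
  initial sums compare; otherwise \<open>\<xi> < c\<close> from \<open>n\<close> on, so \<open>\<xi>\<close> is dominated termwise until \<open>\<eta>\<close>
  drops to \<open>c\<close>, and from there on the truncation coincides with \<open>\<eta>\<close>.
\<close>

lemma l1_starD:
  assumes "x \<in> l1_star"
  shows "decseq x" "0 \<le> x n" "x \<longlonglongrightarrow> 0" "summable x"
  using assms by (auto simp: l1_star_def c0_star_def)

lemma l1_starI:
  assumes "decseq x" "\<And>n. 0 \<le> x n" "summable x"
  shows "x \<in> l1_star"
  using assms summable_LIMSEQ_zero[OF assms(3)] by (auto simp: l1_star_def c0_star_def)

lemma truncation_in_l1_star:
  assumes "y \<in> l1_star" "0 \<le> c"
  shows "(\<lambda>n. min (y n) c) \<in> l1_star"
proof (rule l1_starI)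
  show "decseq (\<lambda>n. min (y n) c)"
    using l1_starD(1)[OF assms(1)] by (fastforce simp: decseq_def)
  show "0 \<le> min (y n) c" for n
    using assms l1_starD(2) by auto
  show "summable (\<lambda>n. min (y n) c)"
    by (rule summable_comparison_test'[OF l1_starD(4)[OF assms(1)], of 0])
      (use assms l1_starD(2) in \<open>auto simp: min_def\<close>)
qed

text \<open>For \<open>c \<ge> 0\<close> the \<open>n\<close>-th term is bounded by
  \<open>y n\<close> independently of \<open>c\<close>, so the partial sums, continuous in
  \<open>c\<close>, converge uniformly by the Weierstrass M-test.\<close>

lemma continuous_on_suminf_truncation:
  fixes y :: "nat \<Rightarrow> real"
  assumes "summable y" "\<And>n. 0 \<le> y n"
  shows "continuous_on {0..} (\<lambda>c. \<Sum>n. min (y n) c)"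
proof (rule uniform_limit_theorem)
  show "uniform_limit {0..} (\<lambda>m c. \<Sum>n<m. min (y n) c) (\<lambda>c. \<Sum>n. min (y n) c) sequentially"
    by (rule Weierstrass_m_test[OF _ assms(1)]) (use assms(2) in \<open>auto simp: min_def\<close>)
qed (auto intro!: always_eventually continuous_intros)

text \<open>Intermediate value theorem in the height: \<open>c = 0\<close> gives the zero sequence,
  and \<open>c = y 0\<close> leaves \<open>y\<close> unchanged because \<open>y 0\<close> is its
  largest term.\<close>

lemma exists_truncation_with_sum:
  assumes y: "y \<in> l1_star" and s: "0 \<le> s" "s \<le> (\<Sum>n. y n)"
  obtains c where "0 \<le> c" "(\<Sum>n. min (y n) c) = s"
proof -
  have "min (y n) 0 = 0" "min (y n) (y 0) = y n" for n
    using l1_starD(1,2)[OF y] by (auto simp: decseq_def)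
  moreover have "continuous_on {0..y 0} (\<lambda>c. \<Sum>n. min (y n) c)"
    by (rule continuous_on_subset[OF continuous_on_suminf_truncation])
      (use l1_starD[OF y] in auto)
  ultimately show ?thesis
    using IVT'[of "\<lambda>c. \<Sum>n. min (y n) c" 0 s "y 0"] s l1_starD(2)[OF y] that by auto
qed

lemma majorized_at_infinity_truncation:
  assumes x: "x \<in> l1_star" and y: "y \<in> l1_star" and maj: "x \<prec>\<^sub>\<infinity> y"
    and c: "0 \<le> c" "(\<Sum>n. min (y n) c) = (\<Sum>n. x n)"
  shows "x \<prec>\<^sub>\<infinity> (\<lambda>n. min (y n) c)"
  unfolding majorized_at_infinity_def
proof
  fix n
  let ?z = "\<lambda>n. min (y n) c"
  note sx = l1_starD(4)[OF x] and sz = l1_starD(4)[OF truncation_in_l1_star[OF y c(1)]]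
  show "(\<Sum>j. x (j + n)) \<le> (\<Sum>j. ?z (j + n))"
  proof (cases "\<forall>j<n. c \<le> x j")
    case True
    then have "(\<Sum>j<n. ?z j) \<le> (\<Sum>j<n. x j)"
      by (intro sum_mono) (simp add: min.coboundedI2)
    \<comment> \<open>The total sums agree by \<open>c(2)\<close>, so the smaller initial sum
      belongs to the larger tail.\<close>
    then show ?thesis
      using suminf_split_initial_segment[OF sx, of n] suminf_split_initial_segment[OF sz, of n] c(2)
      by simp
  next
    case False
    then obtain j where j: "j < n" "x j < c"
      by auto
    have x_le: "x (i + n) \<le> c" for i
      using decseqD[OF l1_starD(1)[OF x], of j "i + n"] j by simp
    \<comment> \<open>Strict positivity is what makes the null sequence \<open>y\<close> eventually
      fall below \<open>c\<close>, so that the \<open>LEAST\<close> below exists.\<close>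
    have "0 < c"
      using l1_starD(2)[OF x, of j] j by simp
    then have "\<forall>\<^sub>F m in sequentially. y (m + n) < c"
      using order_tendstoD(2)[OF LIMSEQ_ignore_initial_segment[OF l1_starD(3)[OF y]]] by blast
    then have ex: "\<exists>m. y (m + n) \<le> c"
      by (auto simp: eventually_sequentially intro: less_imp_le)
    \<comment> \<open>Counted from \<open>n\<close>, the truncation is constantly \<open>c\<close>
      before position \<open>m\<close> and equals \<open>y\<close> from there on;
      \<open>m = 0\<close> is possible.\<close>
    define m where "m = (LEAST m. y (m + n) \<le> c)"
    have y_le: "y (i + m + n) \<le> c" for i
      using decseqD[OF l1_starD(1)[OF y], of "m + n" "i + m + n"] LeastI_ex[OF ex]
      unfolding m_def by simp
    have y_gt: "c < y (i + n)" if "i < m" for i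
      using not_less_Least[of i "\<lambda>m. y (m + n) \<le> c"] that unfolding m_def by auto
    have split: "(\<Sum>i. f (i + n)) = (\<Sum>i. f (i + m + n)) + (\<Sum>i<m. f (i + n))"
      if "summable f" for f :: "nat \<Rightarrow> real"
      using suminf_split_initial_segment[OF summable_ignore_initial_segment[OF that, of n], of m] .
    have "(\<Sum>i<m. x (i + n)) \<le> (\<Sum>i<m. ?z (i + n))"
      using x_le y_gt by (intro sum_mono) (simp add: less_imp_le)
    \<comment> \<open>This is \<open>maj\<close> at index \<open>m + n\<close>, since
      \<open>?z\<close> and \<open>y\<close> agree on that tail.\<close>
    moreover have "(\<Sum>i. x (i + m + n)) \<le> (\<Sum>i. ?z (i + m + n))"
      using maj y_le by (simp add: majorized_at_infinity_def min_absorb1 add.assoc)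
    ultimately show ?thesis
      using split[OF sx] split[OF sz] by simp
  qed
qed

theorem theorem3p12:
  fixes \<xi> \<eta> :: "nat \<Rightarrow> real"
  assumes "\<xi> \<in> l1_star" and "\<eta> \<in> l1_star"
    and "\<xi> \<prec>\<^sub>\<infinity> \<eta>"
  shows "(\<exists>\<zeta>\<in>l1_star. \<xi> \<preceq>\<^sub>\<infinity> \<zeta> \<and> \<zeta> \<le> \<eta>)
       \<and> (\<exists>\<rho>\<in>l1_star. \<xi> \<le> \<rho> \<and> \<rho> \<preceq>\<^sub>\<infinity> \<eta>)"
proof
  note \<xi> = l1_starD[OF assms(1)]
  have tail: "(\<Sum>j. \<xi> (j + n)) \<le> (\<Sum>j. \<eta> (j + n))" for n
    using assms(3) by (simp add: majorized_at_infinity_def)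
  have sum_le: "(\<Sum>j. \<xi> j) \<le> (\<Sum>j. \<eta> j)"
    using tail[of 0] by simp
  obtain c where c: "0 \<le> c" "(\<Sum>n. min (\<eta> n) c) = (\<Sum>n. \<xi> n)"
    using exists_truncation_with_sum[OF assms(2) suminf_nonneg[OF \<xi>(4,2)] sum_le] .
  show "\<exists>\<zeta>\<in>l1_star. \<xi> \<preceq>\<^sub>\<infinity> \<zeta> \<and> \<zeta> \<le> \<eta>"
    using truncation_in_l1_star[OF assms(2) c(1)] majorized_at_infinity_truncation[OF assms c] c(2)
    by (intro bexI[of _ "\<lambda>n. min (\<eta> n) c"])
      (auto simp: strongly_majorized_at_infinity_def le_fun_def)
  define \<rho> where "\<rho> = \<xi>(0 := \<xi> 0 + ((\<Sum>j. \<eta> j) - (\<Sum>j. \<xi> j)))"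
  have \<rho>_0: "\<rho> 0 = \<xi> 0 + ((\<Sum>j. \<eta> j) - (\<Sum>j. \<xi> j))"
    by (simp add: \<rho>_def)
  have \<rho>_Suc: "\<rho> (Suc n) = \<xi> (Suc n)" for n
    by (simp add: \<rho>_def)
  have ge: "\<xi> \<le> \<rho>"
    using sum_le by (simp add: \<rho>_def le_fun_def)
  have summable: "summable \<rho>"
    using \<xi>(4) summable_Suc_iff[of \<rho>] summable_Suc_iff[of \<xi>] by (simp add: \<rho>_Suc)
  \<comment> \<open>Raising only the first term of a nonincreasing sequence keeps it
    nonincreasing.\<close>
  have "\<rho> (Suc n) \<le> \<rho> n" for n
    using decseq_SucD[OF \<xi>(1), of n] le_funD[OF ge, of n] by (simp add: \<rho>_Suc)
  then have "\<rho> \<in> l1_star"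
    using \<xi>(2) le_funD[OF ge] summable by (intro l1_starI decseq_SucI) (auto intro: order_trans)
  moreover have sum_eq: "(\<Sum>j. \<rho> j) = (\<Sum>j. \<eta> j)"
    using suminf_split_head[OF summable] suminf_split_head[OF \<xi>(4)]
    by (simp add: \<rho>_Suc \<rho>_0)
  \<comment> \<open>For \<open>n = 0\<close> the total sums are equal; every later tail of
    \<open>\<rho>\<close> misses the altered term and is a tail of \<open>\<xi>\<close>.\<close>
  moreover have "(\<Sum>j. \<rho> (j + n)) \<le> (\<Sum>j. \<eta> (j + n))" for n
    using tail[of n] sum_eq by (cases n) (simp_all add: \<rho>_Suc)
  ultimately show "\<exists>\<rho>\<in>l1_star. \<xi> \<le> \<rho> \<and> \<rho> \<preceq>\<^sub>\<infinity> \<eta>"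
    using ge
    by (auto simp: strongly_majorized_at_infinity_def majorized_at_infinity_def)
qed

end
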